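(* Let $r$ be a positive integer and let $\mathbb{M}=(V,\mathcal{C})$ be the rank-$r$ uniform matroid on $n\ge r+1$ elements, i.e. $\mathcal{C}=\{C\subseteq V:|C|=r+1\}$, $|V|=n$. Let $|\mathbb{M}|_C$ be the minimum cardinality of a subfamily $\mathcal{D}\subseteq\mathcal{C}$ with $\Phi_{\mathcal{D}}=\Phi_{\mathcal{C}}$, and let $c(n,r+1,r)$ be the minimum size of a covering $(n,r+1,r)$-system. Then $c(n,r+1,r)\le|\mathbb{M}|_C\le 2\,c(n,r+1,r)$.
   Context: Boolean functions on $V$ are viewed as functions of subsets; the clause $B\to v$ ($v\notin B$) has true sets the $T$ with $B\not\subseteq T$ or $B\cup\{v\}\subseteq T$; $\Phi_{\mathcal{H}}=\bigwedge_{H\in\mathcal{H}}\bigwedge_{v\in H}((H\setminus\{v\})\to v)$, compared as Boolean functions. A covering $(n,q,r)$-system is a $q$-uniform hypergraph on an $n$-element vertex set such that every $r$-element subset of vertices is contained in at least one hyperedge. *)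

theory Defs
  imports Main
begin

text \<open>A Boolean function on \<open>V\<close> is a predicate on the subsets of \<open>V\<close> (its true sets). It is represented
  by a predicate on all sets, so that equality of Boolean functions has to be relativised to \<open>V\<close>.\<close>

definition eq_on_subsets :: "'a set \<Rightarrow> ('a set \<Rightarrow> bool) \<Rightarrow> ('a set \<Rightarrow> bool) \<Rightarrow> bool" where
  "eq_on_subsets V f g \<longleftrightarrow> (\<forall>T. T \<subseteq> V \<longrightarrow> f T = g T)"

definition implication_clause :: "'a set \<Rightarrow> 'a \<Rightarrow> 'a set \<Rightarrow> bool" where
  "implication_clause B v T \<longleftrightarrow> \<not> B \<subseteq> T \<or> B \<union> {v} \<subseteq> T"

definition Phi :: "'a set set \<Rightarrow> 'a set \<Rightarrow> bool" where
  "Phi \<H> T \<longleftrightarrow> (\<forall>H\<in>\<H>. \<forall>v\<in>H. implication_clause (H - {v}) v T)"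

text \<open>Matroids are given as pairs of a ground set and a family of circuits.\<close>

definition uniform_matroid :: "nat \<Rightarrow> 'a set \<Rightarrow> 'a set \<times> 'a set set" where
  "uniform_matroid r V = (V, {C. C \<subseteq> V \<and> card C = r + 1})"

text \<open>The quantity written $|M|_C$. The set of admissible sizes contains \<open>card \<C>\<close> whenever \<open>\<C>\<close> is
  finite, so the least element is then a genuine minimum.\<close>

definition min_circuits :: "'a set \<times> 'a set set \<Rightarrow> nat" where
  "min_circuits M = (case M of (V, \<C>) \<Rightarrow>
     (LEAST k. \<exists>\<D>. \<D> \<subseteq> \<C> \<and> finite \<D> \<and> card \<D> = k \<and> eq_on_subsets V (Phi \<D>) (Phi \<C>)))"

definition covering_system :: "nat \<Rightarrow> nat \<Rightarrow> nat \<Rightarrow> 'a set \<Rightarrow> 'a set set \<Rightarrow> bool" where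
  "covering_system n q r V \<H> \<longleftrightarrow>
     finite V \<and> card V = n \<and>
     (\<forall>H\<in>\<H>. H \<subseteq> V \<and> card H = q) \<and>
     (\<forall>R. R \<subseteq> V \<and> card R = r \<longrightarrow> (\<exists>H\<in>\<H>. R \<subseteq> H))"

text \<open>Every finite vertex set is in bijection with a set of natural numbers, so vertices may be taken
  in \<^typ>\<open>nat\<close>. The least element is a genuine minimum if \<open>r \<le> q \<le> n\<close>; otherwise a covering system
  need not exist and the value is meaningless.\<close>

definition covering_number :: "nat \<Rightarrow> nat \<Rightarrow> nat \<Rightarrow> nat" where
  "covering_number n q r =
     (LEAST k. \<exists>(V :: nat set) \<H>. covering_system n q r V \<H> \<and> card \<H> = k)"

end

theory Submission
  imports Defs
begin

text \<open>A family of circuits representing \<open>\<Phi>\<close> must cover every \<open>r\<close>-set \<open>R\<close>, since otherwise \<open>R\<close> would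
  be a true set; this is the lower bound. For the upper bound, call a family forcing if a true set
  containing \<open>r\<close> elements of one member contains all members. A forcing covering family represents
  \<open>\<Phi>\<close>. Given a covering \<open>\<H>\<close>, one grows a forcing family \<open>\<D>\<close> greedily: as long as some \<open>r\<close>-set is
  not covered by \<open>\<D>\<close>, connectedness of the Johnson graph gives a covered \<open>R\<close> and an uncovered \<open>R'\<close>
  with \<open>|R \<union> R'| = r + 1\<close>, and one adds \<open>R \<union> R'\<close> together with a member of \<open>\<H>\<close> containing \<open>R'\<close>.
  Every step uses up a new member of \<open>\<H>\<close>.\<close>

section \<open>True sets of \<open>Phi\<close>\<close>

lemma Phi_mono: "Phi \<C> T \<Longrightarrow> \<D> \<subseteq> \<C> \<Longrightarrow> Phi \<D> T"
  unfolding Phi_def by blast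

lemma Phi_superset: "(\<And>H. H \<in> \<H> \<Longrightarrow> H \<subseteq> T) \<Longrightarrow> Phi \<H> T"
  unfolding Phi_def implication_clause_def by blast

text \<open>\<open>R\<close> omits exactly one element \<open>v\<close> of \<open>E\<close>, so
  \<open>T\<close> satisfies the body of the clause \<open>E - {v}\<close> \<rightarrow>
  \<open>v\<close> and must contain its head too.\<close>

lemma Phi_subset:
  assumes "Phi \<D> T" "E \<in> \<D>" "card E = r + 1" "R \<subseteq> E" "R \<subseteq> T" "card R = r"
  shows "E \<subseteq> T"
proof -
  have "finite E" using assms(3) by (metis add_is_0 card.infinite one_neq_zero)
  then have "card (E - R) = 1"
    using assms by (simp add: card_Diff_subset finite_subset)
  then obtain v where "E - R = {v}" by (auto simp: card_1_singleton_iff)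
  then have "v \<in> E" "E - {v} \<subseteq> T" using assms(4,5) by auto
  then show ?thesis
    using assms(1,2) unfolding Phi_def implication_clause_def by blast
qed

text \<open>Every clause body has \<open>r\<close> elements, so a body inside \<open>T\<close> would
  be all of \<open>T\<close>, and \<open>T\<close> would then be an \<open>r\<close>-set covered by
  a member. This serves both for sets with fewer than \<open>r\<close> elements and for uncovered
  \<open>r\<close>-sets.\<close>

lemma Phi_uncovered:
  assumes "finite T" "card T \<le> r" "\<And>H. H \<in> \<H> \<Longrightarrow> card H = r + 1 \<and> \<not> (T \<subseteq> H \<and> card T = r)"
  shows "Phi \<H> T"
  unfolding Phi_def implication_clause_def
proof (intro ballI)
  fix H v assume H: "H \<in> \<H>" "v \<in> H"
  then have "card (H - {v}) = r" using assms(3) by (simp add: card_Diff_singleton_if)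
  then have "\<not> H - {v} \<subseteq> T"
    using assms H card_seteq[of T "H - {v}"] by (metis Diff_subset card_mono le_antisym)
  then show "\<not> H - {v} \<subseteq> T \<or> H - {v} \<union> {v} \<subseteq> T" ..
qed

section \<open>Covering numbers on an arbitrary vertex set\<close>

lemma finite_covering_system: "covering_system n q r V \<H> \<Longrightarrow> finite \<H>"
  unfolding covering_system_def by (meson Pow_iff finite_Pow_iff rev_finite_subset subsetI)

text \<open>Since \<open>covering_number\<close> takes its vertices in \<nat>, this transport is
  what links it to coverings of the given \<open>V\<close>.\<close>

lemma covering_system_image:
  assumes "covering_system n q r V \<H>" "bij_betw f V W"
  shows "covering_system n q r W ((`) f ` \<H>)" "card ((`) f ` \<H>) = card \<H>"
proof -
  have V: "finite V" "card V = n" "\<And>H. H \<in> \<H> \<Longrightarrow> H \<subseteq> V \<and> card H = q"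
    "\<And>R. R \<subseteq> V \<Longrightarrow> card R = r \<Longrightarrow> \<exists>H\<in>\<H>. R \<subseteq> H"
    using assms(1) unfolding covering_system_def by auto
  have inj: "inj_on f V" and W: "W = f ` V"
    using assms(2) unfolding bij_betw_def by auto
  have "\<exists>H\<in>\<H>. R \<subseteq> f ` H" if R: "R \<subseteq> W" "card R = r" for R
  proof -
    obtain S where S: "S \<subseteq> V" "R = f ` S" using R(1) W by (meson subset_imageE)
    then have "card S = r" using R(2) inj by (metis card_image inj_on_subset)
    then obtain H where "H \<in> \<H>" "S \<subseteq> H" using V(4) S(1) by blast
    then show ?thesis using S(2) by blast
  qed
  moreover have "f ` H \<subseteq> W \<and> card (f ` H) = q" if "H \<in> \<H>" for H
    using V(3)[OF that] W inj card_image[of f H] inj_on_subset[of f V H] by auto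
  moreover have "finite W" "card W = n" using V(1,2) W inj by (simp_all add: card_image)
  ultimately show "covering_system n q r W ((`) f ` \<H>)"
    unfolding covering_system_def by simp
  have "\<H> \<subseteq> Pow V" using V(3) by auto
  then have "inj_on ((`) f) \<H>"
    using inj_on_subset[OF inj_on_image_Pow[OF inj]] by simp
  then show "card ((`) f ` \<H>) = card \<H>" by (rule card_image)
qed

lemma covering_number_le:
  assumes "covering_system n q r V \<H>"
  shows "covering_number n q r \<le> card \<H>"
proof -
  have "finite V" "card V = n" using assms unfolding covering_system_def by auto
  then obtain f where "bij_betw f V {0..<n}" using ex_bij_betw_finite_nat by blast
  from covering_system_image[OF assms this] show ?thesis
    unfolding covering_number_def by (intro Least_le) blast
qed

lemma covering_system_all:
  assumes "finite V" "card V = n" "r \<le> q" "q \<le> n"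
  shows "covering_system n q r V {H. H \<subseteq> V \<and> card H = q}"
proof -
  have "\<exists>H. H \<subseteq> V \<and> card H = q \<and> R \<subseteq> H" if "R \<subseteq> V" "card R = r" for R
    using exists_subset_between[of R q V] that assms by auto
  then show ?thesis using assms unfolding covering_system_def by blast
qed

lemma covering_number_attained:
  assumes "finite V" "card V = n" "r \<le> q" "q \<le> n"
  obtains \<H> where "covering_system n q r V \<H>" "card \<H> = covering_number n q r"
proof -
  have "\<exists>k (W :: nat set) \<H>. covering_system n q r W \<H> \<and> card \<H> = k"
    using covering_system_all[of "{0..<n}" n r q] assms by auto
  from LeastI_ex[OF this] obtain W :: "nat set" and \<H> where
    W: "covering_system n q r W \<H>" "card \<H> = covering_number n q r"
    unfolding covering_number_def by auto
  then have "finite W" "card W = card V" using assms(2) unfolding covering_system_def by auto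
  from finite_same_card_bij[OF this(1) assms(1) this(2)] obtain f where f: "bij_betw f W V" ..
  show thesis
    by (rule that[OF covering_system_image(1)[OF W(1) f]])
      (simp add: covering_system_image(2)[OF W(1) f] W(2))
qed

section \<open>Representing families and the lower bound\<close>

lemma min_circuits_le:
  assumes "finite \<D>" "\<D> \<subseteq> {C. C \<subseteq> V \<and> card C = r + 1}"
    "eq_on_subsets V (Phi \<D>) (Phi {C. C \<subseteq> V \<and> card C = r + 1})"
  shows "min_circuits (uniform_matroid r V) \<le> card \<D>"
  unfolding min_circuits_def uniform_matroid_def prod.case
  using assms by (intro Least_le) blast

lemma min_circuits_attained:
  assumes "finite V"
  obtains \<D> where "\<D> \<subseteq> {C. C \<subseteq> V \<and> card C = r + 1}"
    "eq_on_subsets V (Phi \<D>) (Phi {C. C \<subseteq> V \<and> card C = r + 1})"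
    "card \<D> = min_circuits (uniform_matroid r V)"
proof -
  let ?\<C> = "{C. C \<subseteq> V \<and> card C = r + 1}"
  have "\<exists>k \<D>. \<D> \<subseteq> ?\<C> \<and> finite \<D> \<and> card \<D> = k \<and> eq_on_subsets V (Phi \<D>) (Phi ?\<C>)"
    using assms by (intro exI[of _ "card ?\<C>"] exI[of _ ?\<C>]) (auto simp: eq_on_subsets_def)
  from LeastI_ex[OF this] show thesis
    using that unfolding min_circuits_def uniform_matroid_def prod.case by blast
qed

lemma covering_system_of_representation:
  assumes "finite V" "card V = n" "n \<ge> r + 1" "\<D> \<subseteq> {C. C \<subseteq> V \<and> card C = r + 1}"
    and eq: "eq_on_subsets V (Phi \<D>) (Phi {C. C \<subseteq> V \<and> card C = r + 1})"
  shows "covering_system n (r + 1) r V \<D>"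
proof -
  have "\<exists>H\<in>\<D>. R \<subseteq> H" if R: "R \<subseteq> V" "card R = r" for R
  proof (rule ccontr)
    assume "\<not> (\<exists>H\<in>\<D>. R \<subseteq> H)"
    then have "Phi \<D> R"
      using Phi_uncovered[of R r \<D>] assms R finite_subset by blast
    then have Phi: "Phi {C. C \<subseteq> V \<and> card C = r + 1} R"
      using eq R(1) unfolding eq_on_subsets_def by blast
    have fin: "finite R" using R assms(1) finite_subset by blast
    \<comment> \<open>As \<open>card R = r < n\<close>, some \<open>v\<close> lies outside
      \<open>R\<close>. The circuit \<open>insert v R\<close> yields a clause with body
      \<open>R\<close> and head \<open>v\<close>, which is false at \<open>R\<close>.\<close>
    obtain v where v: "v \<in> V" "v \<notin> R"
      using R assms(2,3) by (metis Suc_eq_plus1 not_less_eq_eq order_refl subsetI subset_antisym)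
    have "insert v R \<in> {C. C \<subseteq> V \<and> card C = r + 1}" using v R fin by simp
    from Phi_subset[OF Phi this, of r R] v R fin show False by auto
  qed
  then show ?thesis using assms unfolding covering_system_def by blast
qed

section \<open>Forcing families and the upper bound\<close>

definition forcing :: "nat \<Rightarrow> 'a set set \<Rightarrow> bool" where
  "forcing r \<D> \<longleftrightarrow> (\<forall>T R. Phi \<D> T \<longrightarrow> R \<subseteq> T \<longrightarrow> card R = r \<longrightarrow> (\<exists>C\<in>\<D>. R \<subseteq> C) \<longrightarrow> \<Union>\<D> \<subseteq> T)"

lemma forcing_singleton: "card E = r + 1 \<Longrightarrow> forcing r {E}"
  unfolding forcing_def using Phi_subset[of "{E}"] by auto

text \<open>The common \<open>r\<close>-set \<open>R\<close> is a bridge: a true set containing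
  \<open>r\<close> elements of \<open>E\<close> contains \<open>E\<close>, hence \<open>R\<close>,
  hence all of \<open>\<Union>\<D>\<close>; one containing \<open>\<Union>\<D>\<close> contains
  \<open>R\<close>, hence \<open>E\<close>.\<close>

lemma forcing_insert:
  assumes "forcing r \<D>" "card E = r + 1" "C \<in> \<D>" "R \<subseteq> C" "R \<subseteq> E" "card R = r"
  shows "forcing r (insert E \<D>)"
  unfolding forcing_def
proof (intro allI impI)
  fix T S
  assume Phi: "Phi (insert E \<D>) T" and S: "S \<subseteq> T" "card S = r" "\<exists>C\<in>insert E \<D>. S \<subseteq> C"
  have Phi': "Phi \<D> T" using Phi Phi_mono by blast
  have step: "E \<subseteq> T" if "Q \<subseteq> E" "Q \<subseteq> T" "card Q = r" for Q
    using Phi_subset[OF Phi _ assms(2)] that by blast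
  have "R \<subseteq> T"
  proof (cases "S \<subseteq> E")
    case True
    then show ?thesis using step S assms(5) by blast
  next
    case False
    then have "\<Union>\<D> \<subseteq> T" using S assms(1) Phi' unfolding forcing_def by blast
    then show ?thesis using assms(3,4) by blast
  qed
  then have "\<Union>\<D> \<subseteq> T" "E \<subseteq> T"
    using assms step Phi' unfolding forcing_def by blast+
  then show "\<Union>(insert E \<D>) \<subseteq> T" by simp
qed

text \<open>Walk from \<open>R\<close> to \<open>S\<close> by exchanging one element of
  \<open>R - S\<close> for one of \<open>S - R\<close> at a time. Somewhere on the way
  \<open>P\<close> is lost, and consecutive sets of the walk have a union of size
  \<open>r + 1\<close>.\<close>

lemma Johnson_graph_boundary:
  assumes "finite V" "R \<subseteq> V" "card R = r" "P R" "S \<subseteq> V" "card S = r" "\<not> P S"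
  shows "\<exists>A B. A \<subseteq> V \<and> B \<subseteq> V \<and> card A = r \<and> card B = r \<and> card (A \<union> B) = r + 1 \<and> P A \<and> \<not> P B"
  using assms
proof (induction "card (R - S)" arbitrary: R rule: less_induct)
  case less
  have fin: "finite R" "finite S" using less.prems finite_subset by auto
  have "\<not> R \<subseteq> S" "\<not> S \<subseteq> R"
    using less.prems fin by (metis card_subset_eq)+
  then obtain x y where xy: "x \<in> R" "x \<notin> S" "y \<in> S" "y \<notin> R" by blast
  define Q where "Q = insert y (R - {x})"
  have Q: "Q \<subseteq> V" "card Q = r" "R \<union> Q = insert y R"
  proof -
    have "card Q = card R" using xy fin card_Suc_Diff1[of R x] by (simp add: Q_def)
    then show "card Q = r" using less.prems by simp
  qed (use xy less.prems Q_def in auto)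
  show ?case
  proof (cases "P Q")
    case True
    \<comment> \<open>The incoming element \<open>y\<close> lies in \<open>S\<close>, so the
      exchange only shrinks the difference.\<close>
    have "Q - S = (R - S) - {x}" using xy Q_def by auto
    then have "card (Q - S) < card (R - S)"
      using xy fin by (simp add: card_Diff1_less del: card_Diff_insert)
    with less.hyps[OF this] less.prems Q True show ?thesis by blast
  next
    case False
    have "card (R \<union> Q) = r + 1" using Q(3) xy fin less.prems by simp
    then show ?thesis using False Q less.prems by blast
  qed
qed

lemma forcing_covering_exists:
  assumes cov: "covering_system n (r + 1) r V \<H>" and n: "n \<ge> r + 1"
  obtains \<D> where "covering_system n (r + 1) r V \<D>" "forcing r \<D>" "card \<D> \<le> 2 * card \<H>"
proof -
  have V: "finite V" "card V = n" "\<And>H. H \<in> \<H> \<Longrightarrow> H \<subseteq> V \<and> card H = r + 1"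
    "\<And>R. R \<subseteq> V \<Longrightarrow> card R = r \<Longrightarrow> \<exists>H\<in>\<H>. R \<subseteq> H"
    using cov unfolding covering_system_def by auto
  \<comment> \<open>\<open>S\<close> records the members of \<open>\<H>\<close> used so far; each of
    them pays for at most two members of \<open>\<D>\<close>. Nonemptiness of \<open>\<D>\<close>
    supplies a covered \<open>r\<close>-set as the start of the walk.\<close>
  define good where "good S \<D> \<longleftrightarrow> S \<subseteq> \<H> \<and> S \<subseteq> \<D> \<and> \<D> \<noteq> {} \<and> finite \<D> \<and> forcing r \<D> \<and>
    card \<D> \<le> 2 * card S \<and> (\<forall>C\<in>\<D>. C \<subseteq> V \<and> card C = r + 1)" for S \<D>
  have fin: "finite \<H>" using cov by (rule finite_covering_system)
  obtain R0 where "R0 \<subseteq> V" "card R0 = r"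
    using V(2) n by (metis add_leD1 obtain_subset_with_card_n)
  then obtain H0 where H0: "H0 \<in> \<H>" using V(4) by blast
  have "good {H0} {H0}" unfolding good_def using H0 V(3) forcing_singleton by auto
  then have ex: "\<exists>\<D>. good {H0} \<D>" by blast
  have bound: "card S < Suc (card \<H>)" if "\<exists>\<D>. good S \<D>" for S
  proof -
    have "S \<subseteq> \<H>" using that unfolding good_def by blast
    with fin show ?thesis by (simp add: card_mono less_Suc_eq_le)
  qed
  \<comment> \<open>A largest \<open>S\<close>, which exists because \<open>S\<close> stays inside
    the finite \<open>\<H>\<close>, replaces the iteration of the greedy step: one further step
    would contradict maximality.\<close>
  obtain S where S: "\<exists>\<D>. good S \<D>" "\<And>S'. (\<exists>\<D>. good S' \<D>) \<Longrightarrow> card S' \<le> card S"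
    using ex_has_greatest_nat[of "\<lambda>S. \<exists>\<D>. good S \<D>" "{H0}" card "Suc (card \<H>)", OF ex]
      bound by blast
  then obtain \<D> where "good S \<D>" by blast
  then have D: "S \<subseteq> \<H>" "S \<subseteq> \<D>" "\<D> \<noteq> {}" "finite \<D>" "forcing r \<D>" "card \<D> \<le> 2 * card S"
    "\<And>C. C \<in> \<D> \<Longrightarrow> C \<subseteq> V \<and> card C = r + 1"
    unfolding good_def by auto
  have "\<exists>C\<in>\<D>. Q \<subseteq> C" if Q: "Q \<subseteq> V" "card Q = r" for Q
  proof (rule ccontr)
    assume nQ: "\<not> (\<exists>C\<in>\<D>. Q \<subseteq> C)"
    obtain C0 where C0: "C0 \<in> \<D>" using D(3) by blast
    then obtain R1 where R1: "R1 \<subseteq> C0" "card R1 = r"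
      using D(7) obtain_subset_with_card_n[of r C0] by (metis le_add1)
    have "R1 \<subseteq> V" using R1 C0 D(7) by blast
    with Johnson_graph_boundary[of V R1 r "\<lambda>R. \<exists>C\<in>\<D>. R \<subseteq> C" Q] obtain A B where
      AB: "A \<subseteq> V" "B \<subseteq> V" "card A = r" "card B = r" "card (A \<union> B) = r + 1"
        "\<exists>C\<in>\<D>. A \<subseteq> C" "\<not> (\<exists>C\<in>\<D>. B \<subseteq> C)"
      using V(1) R1 C0 Q nQ by blast
    obtain H where H: "H \<in> \<H>" "B \<subseteq> H" using V(4) AB by blast
    \<comment> \<open>\<open>H\<close> covers \<open>B\<close>, which no member of
      \<open>\<D>\<close> does, so \<open>H\<close> is a member of \<open>\<H>\<close> not yet
      used.\<close>
    have HD: "H \<notin> \<D>" "H \<notin> S" using H AB(7) D(2) by auto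
    obtain C where C: "C \<in> \<D>" "A \<subseteq> C" using AB(6) by blast
    \<comment> \<open>Two bridges: \<open>A\<close> joins \<open>A \<union> B\<close> to the old
      member \<open>C\<close>, then \<open>B\<close> joins \<open>H\<close> to
      \<open>A \<union> B\<close>.\<close>
    have "forcing r (insert (A \<union> B) \<D>)"
      by (rule forcing_insert[OF D(5) AB(5) C]) (use AB in auto)
    then have "forcing r (insert H (insert (A \<union> B) \<D>))"
      by (rule forcing_insert[where C = "A \<union> B" and R = B]) (use AB H V(3) in auto)
    moreover have "card (insert H (insert (A \<union> B) \<D>)) \<le> 2 * card (insert H S)"
    proof -
      have "finite S" using D(2,4) finite_subset by blast
      then have "card (insert H S) = card S + 1" using HD by simp
      moreover have "card (insert H (insert (A \<union> B) \<D>)) \<le> card \<D> + 2"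
        using D(4) by (simp add: card_insert_if)
      ultimately show ?thesis using D(6) by simp
    qed
    ultimately have "good (insert H S) (insert H (insert (A \<union> B) \<D>))"
      unfolding good_def using D H V(3) AB by auto
    then have "card (insert H S) \<le> card S" using S(2) by blast
    moreover have "finite S" using D(2,4) finite_subset by blast
    ultimately show False using HD by simp
  qed
  then have "covering_system n (r + 1) r V \<D>"
    unfolding covering_system_def using V(1,2) D(7) by simp
  moreover have "card \<D> \<le> 2 * card \<H>"
    using D(1,6) fin card_mono[of \<H> S] by linarith
  ultimately show thesis using that D(5) by blast
qed

text \<open>A true set with fewer than \<open>r\<close> elements contains no clause body of either
  family. A larger one contains a covered \<open>r\<close>-set, so forcing makes it all of
  \<open>V\<close>, where every clause holds.\<close>

lemma representation_of_forcing_covering: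
  assumes cov: "covering_system n (r + 1) r V \<D>" and "forcing r \<D>" "r \<ge> 1" "n \<ge> r + 1"
  shows "eq_on_subsets V (Phi \<D>) (Phi {C. C \<subseteq> V \<and> card C = r + 1})"
  unfolding eq_on_subsets_def
proof (intro allI impI iffI)
  have V: "finite V" "card V = n" "\<And>H. H \<in> \<D> \<Longrightarrow> H \<subseteq> V \<and> card H = r + 1"
    "\<And>R. R \<subseteq> V \<Longrightarrow> card R = r \<Longrightarrow> \<exists>H\<in>\<D>. R \<subseteq> H"
    using cov unfolding covering_system_def by auto
  fix T assume T: "T \<subseteq> V"
  let ?\<C> = "{C. C \<subseteq> V \<and> card C = r + 1}"
  show "Phi \<D> T" if "Phi ?\<C> T"
    using Phi_mono[OF that] V(3) by blast
  show "Phi ?\<C> T" if Phi: "Phi \<D> T"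
  proof (cases "card T < r")
    case True
    then show ?thesis using T V(1) by (intro Phi_uncovered[of T r]) (auto intro: finite_subset)
  next
    case False
    then obtain R where R: "R \<subseteq> T" "card R = r"
      by (metis not_less obtain_subset_with_card_n)
    then have "\<exists>C\<in>\<D>. R \<subseteq> C" using V(4)[of R] T by simp
    then have "\<Union>\<D> \<subseteq> T"
      using assms(2) Phi R unfolding forcing_def by metis
    \<comment> \<open>Because \<open>r \<ge> 1\<close>, each vertex lies in some
      \<open>r\<close>-subset of \<open>V\<close>, and that subset is covered; so the members of
      \<open>\<D>\<close> exhaust \<open>V\<close>.\<close>
    moreover have "x \<in> \<Union>\<D>" if "x \<in> V" for x
    proof -
      have "\<exists>Q. {x} \<subseteq> Q \<and> Q \<subseteq> V \<and> card Q = r"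
        by (rule exists_subset_between) (use that V(1,2) assms(3,4) in auto)
      then obtain Q where "{x} \<subseteq> Q" "Q \<subseteq> V" "card Q = r" by blast
      then show ?thesis using V(4)[of Q] by blast
    qed
    ultimately have "V \<subseteq> T" by blast
    then show ?thesis by (intro Phi_superset) blast
  qed
qed

theorem theorem21:
  fixes V :: "'a set" and n r :: nat
  assumes "r \<ge> 1" and "finite V" and "card V = n" and "n \<ge> r + 1"
  shows "covering_number n (r + 1) r \<le> min_circuits (uniform_matroid r V) \<and>
         min_circuits (uniform_matroid r V) \<le> 2 * covering_number n (r + 1) r"
proof
  obtain \<D> where D: "\<D> \<subseteq> {C. C \<subseteq> V \<and> card C = r + 1}"
    "eq_on_subsets V (Phi \<D>) (Phi {C. C \<subseteq> V \<and> card C = r + 1})"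
    "card \<D> = min_circuits (uniform_matroid r V)"
    using min_circuits_attained[OF assms(2)] .
  from covering_number_le[OF covering_system_of_representation[OF assms(2-4) D(1,2)]]
  show "covering_number n (r + 1) r \<le> min_circuits (uniform_matroid r V)"
    using D(3) by simp
next
  obtain \<H> where H: "covering_system n (r + 1) r V \<H>" "card \<H> = covering_number n (r + 1) r"
    using covering_number_attained[of V n r "r + 1"] assms by auto
  obtain \<D> where D: "covering_system n (r + 1) r V \<D>" "forcing r \<D>" "card \<D> \<le> 2 * card \<H>"
    using forcing_covering_exists[OF H(1) assms(4)] .
  have "\<D> \<subseteq> {C. C \<subseteq> V \<and> card C = r + 1}"
    using D(1) unfolding covering_system_def by blast
  from min_circuits_le[OF finite_covering_system[OF D(1)] this
      representation_of_forcing_covering[OF D(1,2) assms(1,4)]]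
  show "min_circuits (uniform_matroid r V) \<le> 2 * covering_number n (r + 1) r"
    using D(3) H(2) by simp
qed

end
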